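(* Let $n\ge 1$, let $p_1,p_2,\dots,p_n$ be distinct primes, and let $a_1,a_2,\dots,a_n\in\mathbb{N}$. Assume that $\gcd(a_i,\,p_1p_2\cdots p_n)=p_i$ for every $1\le i\le n$. Then $$a_1^{L}+a_2^{L}+\cdots+a_n^{L}\equiv n-1 \pmod{p_1p_2\cdots p_n}$$ for every integer $L>0$ such that $\operatorname{lcm}(p_1-1,p_2-1,\dots,p_n-1)$ divides $L$.
   Context: $\mathbb{N}$ denotes the set of positive integers. *)

theory Defs
  imports "HOL-Number_Theory.Number_Theory"
begin

end

theory Submission
  imports Defs
begin

text \<open>By the Chinese remainder theorem it suffices to work modulo a single \<open>p j\<close>. The gcd
  condition says that \<open>p j\<close> divides \<open>a i\<close> exactly when \<open>i = j\<close>, so the \<open>j\<close>-th summand vanishes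
  and each of the other \<open>n - 1\<close> summands is \<open>1\<close> by Fermat's little theorem.\<close>

lemma fermat_power_cong_1:
  fixes q a L :: nat
  assumes "prime q" "\<not> q dvd a" "(q - 1) dvd L"
  shows "[a ^ L = 1] (mod q)"
proof -
  obtain k where "L = (q - 1) * k"
    using assms(3) by blast
  moreover have "[(a ^ (q - 1)) ^ k = 1 ^ k] (mod q)"
    using assms(1,2) by (intro cong_pow fermat_theorem)
  ultimately show ?thesis
    by (simp add: power_mult)
qed

theorem theorem4:
  fixes n :: nat and p a :: "nat \<Rightarrow> nat"
  assumes "n \<ge> 1"
    and "\<And>i. i \<in> {1..n} \<Longrightarrow> prime (p i)"
    and "inj_on p {1..n}"
    and "\<And>i. i \<in> {1..n} \<Longrightarrow> a i > 0"
    and "\<And>i. i \<in> {1..n} \<Longrightarrow> gcd (a i) (\<Prod>j = 1..n. p j) = p i"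
  shows "\<forall>L::nat. L > 0 \<longrightarrow> (LCM i\<in>{1..n}. p i - 1) dvd L \<longrightarrow>
    [(\<Sum>i = 1..n. a i ^ L) = n - 1] (mod (\<Prod>i = 1..n. p i))"
proof (intro allI impI)
  fix L :: nat
  assume "L > 0" and L: "(LCM i\<in>{1..n}. p i - 1) dvd L"
  have p_dvd_a_iff: "p j dvd a i \<longleftrightarrow> i = j" if "i \<in> {1..n}" "j \<in> {1..n}" for i j
  proof
    assume "p j dvd a i"
    moreover have "p j dvd (\<Prod>k = 1..n. p k)"
      using that by (intro dvd_prodI) auto
    \<comment> \<open>A common divisor of \<open>a i\<close> and the full product divides their gcd,
      which is \<open>p i\<close>.\<close>
    ultimately have "p j dvd p i"
      using assms(5)[OF that(1)] by (metis gcd_greatest)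
    then have "p j = p i"
      using assms(2) that primes_dvd_imp_eq by blast
    then show "i = j"
      using assms(3) that by (metis inj_onD)
  next
    assume "i = j"
    then show "p j dvd a i"
      using assms(5)[OF that(1)] by (metis gcd_dvd1)
  qed
  have "[(\<Sum>i = 1..n. a i ^ L) = n - 1] (mod p j)" if j: "j \<in> {1..n}" for j
  proof -
    have "(p j - 1) dvd L"
      using L j by (meson dvd_Lcm dvd_trans imageI)
    \<comment> \<open>For \<open>i\<close> other than \<open>j\<close>, \<open>p j\<close> does not
      divide \<open>a i\<close>, so Fermat applies term by term.\<close>
    then have "[(\<Sum>i\<in>{1..n} - {j}. a i ^ L) = (\<Sum>i\<in>{1..n} - {j}. 1)] (mod p j)"
      using assms(2)[OF j] p_dvd_a_iff j by (intro cong_sum fermat_power_cong_1) auto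
    \<comment> \<open>Positivity of \<open>L\<close> is essential: \<open>a j ^ 0\<close> would be
      1.\<close>
    moreover have "[a j ^ L = 0] (mod p j)"
      using p_dvd_a_iff[OF j j] \<open>L > 0\<close> by (simp add: cong_0_iff dvd_power_iff_le dvd_trans dvd_power)
    ultimately have "[a j ^ L + (\<Sum>i\<in>{1..n} - {j}. a i ^ L) = 0 + (\<Sum>i\<in>{1..n} - {j}. 1)] (mod p j)"
      by (intro cong_add)
    \<comment> \<open>The ones add up to the cardinality of \<open>{1..n} - {j}\<close>, which is
      \<open>n - 1\<close> because \<open>j\<close> lies in \<open>{1..n}\<close>.\<close>
    then show ?thesis
      using j by (simp add: sum.remove)
  qed
  \<comment> \<open>Pairwise coprimality lets the congruences modulo each \<open>p j\<close> combine
    into one modulo the product.\<close>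
  moreover have "coprime (p i) (p j)" if "i \<in> {1..n}" "j \<in> {1..n}" "i \<noteq> j" for i j
    using that assms(2,3) by (metis inj_onD primes_coprime)
  ultimately show "[(\<Sum>i = 1..n. a i ^ L) = n - 1] (mod (\<Prod>i = 1..n. p i))"
    by (intro coprime_cong_prod_nat) auto
qed

end
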